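(* Let $G$ be a finite group and $S=\{s_1,\dots,s_k\}$ a generating set for $G$ of cardinality $k\ge 1$. Then the graph $D_{G,S}$ satisfies $\mathrm{Aut}(D_{G,S}) \cong G$.
   Context: Notation: $[k]=\{1,\dots,k\}$. $G$ is a finite group, $S=\{s_1,\dots,s_k\}$ is a generating set with $k\ge1$ (distinct) elements in the fixed ordering $s_1<\dots<s_k$. For $d\in[k]$ put $d^+=d+1$ if $d<k$ and $k^+=1$. $\mathrm{Aut}(\Gamma)$ is the group of graph automorphisms of the undirected graph $\Gamma$. The Cayley graph $\mathrm{Cay}_{G,S}$ is the edge-coloured directed graph with vertex set $G$ and a directed edge $(g,gs_d)$ of colour $d$ for all $g\in G$, $d\in[k]$. $d$-chain: for an edge $(g,h)$ of colour $d$ (so $h=gs_d$), $\mathfrak{C}_{[d,g,h]}$ is the graph with $2d+10$ vertices labelled $u_1,\dots,u_d,\ell_1,\dots,\ell_d,0,1,\dots,9$ (the vertex with label $v$ is written $\mathfrak{C}_{[d,g,h]}(v)$) and edges (written via labels): $\{u_i,u_{i+1}\}$ and $\{\ell_i,\ell_{i+1}\}$ for $1\le i<d$; $\{u_i,\ell_i\}$ for $1\le i\le d$; $\{u_d,4\}$, $\{\ell_d,7\}$; and $\{0,1\},\{0,2\},\{0,3\},\{1,3\},\{1,6\},\{2,4\},\{2,5\},\{3,5\},\{4,7\},\{5,8\},\{6,9\},\{7,8\},\{8,9\}$. Blow-up graph $A_g$ of $g\in G$: - If $k\ge3$: vertices $a_g^{d.1},a_g^{d.2},a_g^{d.3},a_g^{d.4}$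 (connector vertices) and $c_g^{d.1},c_g^{d.2}$ (center vertices) for $d\in[k]$; edges, for each $d\in[k]$, $\{a_g^{d.1},a_g^{d.2}\}$, $\{a_g^{d.2},c_g^{d.1}\}$, $\{c_g^{d.1},a_g^{d.3}\}$, $\{a_g^{d.3},a_g^{d.4}\}$, $\{c_g^{d.1},c_g^{d.2}\}$, $\{c_g^{d.2},c_g^{d^+.2}\}$, $\{a_g^{d.4},a_g^{d^+.1}\}$. - If $k=2$: vertices $a_g^{d.1},\dots,a_g^{d.4},c_g^{d.1}$ for $d\in\{1,2\}$; edges $\{a_g^{d.1},a_g^{d.2}\}$, $\{a_g^{d.2},c_g^{d.1}\}$, $\{c_g^{d.1},a_g^{d.3}\}$, $\{a_g^{d.3},a_g^{d.4}\}$, $\{a_g^{d.4},a_g^{d^+.1}\}$ for $d\in\{1,2\}$, and $\{c_g^{1.1},c_g^{2.1}\}$. - If $k=1$: vertices $a_g^{1.1},\dots,a_g^{1.4}$; edges $\{a_g^{1.1},a_g^{1.2}\},\{a_g^{1.2},a_g^{1.3}\},\{a_g^{1.3},a_g^{1.4}\},\{a_g^{1.4},a_g^{1.1}\}$. The graph $D_{G,S}$ is the (cubic, undirected) graph obtained from the disjoint union of all $A_g$, $g\in G$, and all $\mathfrak{C}_{[d,g,h]}$, one for each $d\in[k]$ and each edge $(g,h)$ of colour $d$ of $\mathrm{Cay}_{G,S}$, by adding for each such edge the four edges $\{a_g^{d.1},\mathfrak{C}_{[d,g,h]}(u_1)\}$, $\{a_g^{d.2},\mathfrak{C}_{[d,g,h]}(\ell_1)\}$,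 $\{\mathfrak{C}_{[d,g,h]}(6),a_h^{d.4}\}$, $\{\mathfrak{C}_{[d,g,h]}(9),a_h^{d.3}\}$. *)

theory Defs
  imports "HOL-Algebra.Algebra"
begin

record 'v ugraph =
  verts :: "'v set"
  edges :: "'v set set"

text \<open>
  Elements of \<open>Bij V\<close> are extensional functions, so every permutation of the vertex set is
  represented by exactly one function; the product in \<open>Aut \<Gamma>\<close> is composition on the vertex set.
\<close>

definition graph_aut :: "'v ugraph \<Rightarrow> ('v \<Rightarrow> 'v) set" where
  "graph_aut \<Gamma> = {f \<in> Bij (verts \<Gamma>).
     \<forall>u\<in>verts \<Gamma>. \<forall>v\<in>verts \<Gamma>. {f u, f v} \<in> edges \<Gamma> \<longleftrightarrow> {u, v} \<in> edges \<Gamma>}"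

definition Aut :: "'v ugraph \<Rightarrow> ('v \<Rightarrow> 'v) monoid" where
  "Aut \<Gamma> = BijGroup (verts \<Gamma>) \<lparr>carrier := graph_aut \<Gamma>\<rparr>"

definition cyclic_succ :: "nat \<Rightarrow> nat \<Rightarrow> nat" where
  "cyclic_succ k d = (if d < k then d + 1 else 1)"

text \<open>
  The generators are \<open>s 1, \<dots>, s k\<close>. In the Cayley graph, a directed edge is determined by its
  colour and its end points, so edges are represented as triples \<open>(d, g, h)\<close>.
\<close>

definition cayley_edges :: "('a, 'm) monoid_scheme \<Rightarrow> nat \<Rightarrow> (nat \<Rightarrow> 'a) \<Rightarrow> (nat \<times> 'a \<times> 'a) set"
  where "cayley_edges G k s = {(d, g, g \<otimes>\<^bsub>G\<^esub> s d) | d g. d \<in> {1..k} \<and> g \<in> carrier G}"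

datatype label = U nat | L nat | N nat

text \<open>
  \<open>Conn g d i\<close> is the connector vertex \<open>a\<close> and \<open>Cent g d i\<close> the center vertex \<open>c\<close> of the blow-up
  of \<open>g\<close>, both with superscript \<open>d.i\<close>; \<open>Chain d g h v\<close> is the vertex labelled \<open>v\<close> of the
  \<open>d\<close>-chain of the edge \<open>(g, h)\<close>. All unions below are thereby disjoint by construction.
\<close>

datatype 'a vertex =
    Conn 'a nat nat
  | Cent 'a nat nat
  | Chain nat 'a 'a label

definition chain_label_edges :: "nat \<Rightarrow> label set set" where
  "chain_label_edges d =
     {{U i, U (i + 1)} | i. 1 \<le> i \<and> i < d} \<union>
     {{L i, L (i + 1)} | i. 1 \<le> i \<and> i < d} \<union>
     {{U i, L i} | i. 1 \<le> i \<and> i \<le> d} \<union>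
     {{U d, N 4}, {L d, N 7}} \<union>
     {{N 0, N 1}, {N 0, N 2}, {N 0, N 3}, {N 1, N 3}, {N 1, N 6}, {N 2, N 4}, {N 2, N 5},
      {N 3, N 5}, {N 4, N 7}, {N 5, N 8}, {N 6, N 9}, {N 7, N 8}, {N 8, N 9}}"

definition chain :: "nat \<Rightarrow> 'a \<Rightarrow> 'a \<Rightarrow> 'a vertex ugraph" where
  "chain d g h =
     \<lparr>verts = Chain d g h ` (U ` {1..d} \<union> L ` {1..d} \<union> N ` {0..9}),
      edges = (\<lambda>e. Chain d g h ` e) ` chain_label_edges d\<rparr>"

definition blow_up :: "nat \<Rightarrow> 'a \<Rightarrow> 'a vertex ugraph" where
  "blow_up k g =
     (if k \<ge> 3 then
        \<lparr>verts = {Conn g d i | d i. d \<in> {1..k} \<and> i \<in> {1..4}} \<union>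
                 {Cent g d i | d i. d \<in> {1..k} \<and> i \<in> {1..2}},
         edges = (\<Union>d\<in>{1..k}.
           {{Conn g d 1, Conn g d 2}, {Conn g d 2, Cent g d 1}, {Cent g d 1, Conn g d 3},
            {Conn g d 3, Conn g d 4}, {Cent g d 1, Cent g d 2},
            {Cent g d 2, Cent g (cyclic_succ k d) 2},
            {Conn g d 4, Conn g (cyclic_succ k d) 1}})\<rparr>
      else if k = 2 then
        \<lparr>verts = {Conn g d i | d i. d \<in> {1..2} \<and> i \<in> {1..4}} \<union> {Cent g d 1 | d. d \<in> {1..2}},
         edges = (\<Union>d\<in>{1..2}.
           {{Conn g d 1, Conn g d 2}, {Conn g d 2, Cent g d 1}, {Cent g d 1, Conn g d 3},
            {Conn g d 3, Conn g d 4}, {Conn g d 4, Conn g (cyclic_succ k d) 1}}) \<union>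
           {{Cent g 1 1, Cent g 2 1}}\<rparr>
      else
        \<lparr>verts = {Conn g 1 i | i. i \<in> {1..4}},
         edges = {{Conn g 1 1, Conn g 1 2}, {Conn g 1 2, Conn g 1 3},
                  {Conn g 1 3, Conn g 1 4}, {Conn g 1 4, Conn g 1 1}}\<rparr>)"

definition link_edges :: "nat \<Rightarrow> 'a \<Rightarrow> 'a \<Rightarrow> 'a vertex set set" where
  "link_edges d g h =
     {{Conn g d 1, Chain d g h (U 1)}, {Conn g d 2, Chain d g h (L 1)},
      {Chain d g h (N 6), Conn h d 4}, {Chain d g h (N 9), Conn h d 3}}"

definition D_graph :: "('a, 'm) monoid_scheme \<Rightarrow> nat \<Rightarrow> (nat \<Rightarrow> 'a) \<Rightarrow> 'a vertex ugraph" where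
  "D_graph G k s =
     \<lparr>verts = (\<Union>g\<in>carrier G. verts (blow_up k g)) \<union>
              (\<Union>(d, g, h)\<in>cayley_edges G k s. verts (chain d g h)),
      edges = (\<Union>g\<in>carrier G. edges (blow_up k g)) \<union>
              (\<Union>(d, g, h)\<in>cayley_edges G k s. edges (chain d g h) \<union> link_edges d g h)\<rparr>"

end

theory Submission
  imports Defs
begin

text \<open>
  Left multiplication by a group element acts on \<open>D_graph G k s\<close>, so only the converse needs an
  argument: every automorphism \<open>f\<close> is such a translation. The triangle \<open>0, 1, 3\<close> of a chain together
  with the square \<open>0, 2, 5, 3\<close> is a subgraph (a \<^emph>\<open>house\<close>) that occurs only in chains, so \<open>f\<close> maps
  houses to houses, and it cannot reflect them. As the graph is cubic, knowing \<open>f\<close> at a vertex and at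
  two of its neighbours determines it at the third; in this way \<open>f\<close> is propagated from the house along
  the whole ladder of the chain into the blow-up graph at its lower end. The first place where a rung
  is missing reveals the length of the ladder, so \<open>f\<close> preserves colours. Hence \<open>f\<close> induces a
  colour-preserving automorphism of the Cayley graph, that is, a left multiplication.
\<close>

declare One_nat_def [simp del]

subsection \<open>Adjacency\<close>

definition cyclic_pred :: "nat \<Rightarrow> nat \<Rightarrow> nat" where
  "cyclic_pred k d = (if d > 1 then d - 1 else k)"

lemma cyclic_in_range [simp]:
  assumes "1 \<le> d" "d \<le> k"
  shows "1 \<le> cyclic_succ k d" "cyclic_succ k d \<le> k" "1 \<le> cyclic_pred k d" "cyclic_pred k d \<le> k"
  using assms by (auto simp: cyclic_succ_def cyclic_pred_def)

lemma cyclic_succ_cyclic_pred [simp]: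
  assumes "1 \<le> d" "d \<le> k"
  shows "cyclic_succ k (cyclic_pred k d) = d" "cyclic_pred k (cyclic_succ k d) = d"
  using assms by (auto simp: cyclic_succ_def cyclic_pred_def)

section \<open>Neighbourhoods inside a single chain\<close>

definition labels :: "nat \<Rightarrow> label set" where
  "labels d = U ` {1..d} \<union> L ` {1..d} \<union> N ` {0..9}"

text \<open>Neighbours inside the chain only: \<open>U 1\<close>, \<open>L 1\<close>,
  \<open>N 6\<close> and \<open>N 9\<close> receive just two, since their third neighbour is a
  connector vertex.\<close>

fun label_nbr :: "nat \<Rightarrow> label \<Rightarrow> label set" where
  "label_nbr d (U i) = {L i, if i < d then U (i + 1) else N 4} \<union> (if i = 1 then {} else {U (i - 1)})"
| "label_nbr d (L i) = {U i, if i < d then L (i + 1) else N 7} \<union> (if i = 1 then {} else {L (i - 1)})"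
| "label_nbr d (N i) =
    (if i = 0 then {N 1, N 2, N 3}
     else if i = 1 then {N 0, N 3, N 6}
     else if i = 2 then {N 0, N 4, N 5}
     else if i = 3 then {N 0, N 1, N 5}
     else if i = 4 then {N 2, N 7, U d}
     else if i = 5 then {N 2, N 3, N 8}
     else if i = 6 then {N 1, N 9}
     else if i = 7 then {N 4, N 8, L d}
     else if i = 8 then {N 5, N 7, N 9}
     else {N 6, N 8})"

text \<open>The assumption excludes the junk values of \<open>label_nbr\<close> at labels that do
  not occur in a chain of colour \<open>d\<close>.\<close>

lemma label_nbr_iff:
  assumes "a \<in> labels d"
  shows "{a, b} \<in> chain_label_edges d \<longleftrightarrow> b \<in> label_nbr d a"
proof (cases a)
  case (U i)
  with assms show ?thesis
    by (auto simp: labels_def chain_label_edges_def doubleton_eq_iff) presburger+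
next
  case (L i)
  with assms show ?thesis
    by (auto simp: labels_def chain_label_edges_def doubleton_eq_iff) presburger+
next
  case (N i)
  with assms have "i \<in> {0..9}" by (auto simp: labels_def)
  then have "i = 0 \<or> i = 1 \<or> i = 2 \<or> i = 3 \<or> i = 4 \<or> i = 5 \<or> i = 6 \<or> i = 7 \<or> i = 8 \<or> i = 9"
    by (auto simp: One_nat_def)
  with N show ?thesis
    by (elim disjE) (auto simp: chain_label_edges_def doubleton_eq_iff)
qed

lemma chain_label_edges_subset:
  "1 \<le> d \<Longrightarrow> e \<in> chain_label_edges d \<Longrightarrow> e \<subseteq> labels d"
  by (auto simp: chain_label_edges_def labels_def)

section \<open>Vertices and edges of the whole graph\<close>

locale cayley_blow_up = group G for G (structure) +
  fixes k :: nat and s :: "nat \<Rightarrow> 'a"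
  assumes k_pos: "1 \<le> k"
    and s_closed [simp]: "\<And>d. 1 \<le> d \<Longrightarrow> d \<le> k \<Longrightarrow> s d \<in> carrier G"
    and s_generate: "generate G (s ` {1..k}) = carrier G"
begin

abbreviation V where "V \<equiv> verts (D_graph G k s)"
abbreviation E where "E \<equiv> edges (D_graph G k s)"

lemma Conn_in_V: "Conn g d i \<in> V \<longleftrightarrow> g \<in> carrier G \<and> d \<in> {1..k} \<and> i \<in> {1..4}"
proof -
  have "\<not> 3 \<le> k \<Longrightarrow> k \<noteq> 2 \<Longrightarrow> k = 1" using k_pos by linarith
  then show ?thesis
    by (auto simp: D_graph_def blow_up_def chain_def)
qed

lemma Cent_in_V: "Cent g d i \<in> V \<longleftrightarrow>
    g \<in> carrier G \<and> d \<in> {1..k} \<and> (i = 1 \<and> k \<ge> 2 \<or> i = 2 \<and> k \<ge> 3)"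
  by (auto simp: D_graph_def blow_up_def chain_def split: if_splits)

lemma Chain_in_V: "Chain d g h l \<in> V \<longleftrightarrow>
    g \<in> carrier G \<and> d \<in> {1..k} \<and> h = g \<otimes> s d \<and> l \<in> labels d"
proof -
  have "Chain d g h l \<notin> verts (blow_up k x)" for x
    by (auto simp: blow_up_def)
  moreover have "verts (chain e x y) = Chain e x y ` labels e" for e and x y :: 'a
    by (simp add: chain_def labels_def)
  ultimately show ?thesis
    by (auto simp: D_graph_def cayley_edges_def)
qed

text \<open>One description for all three shapes of the blow-up graph: for \<open>k = 1\<close>
  connectors 2 and 3 are joined directly, there being no center vertex between them, and
  \<open>cyclic_succ\<close> then closes the square.\<close>

lemma blow_up_edge_Conn_Conn:
  "{Conn g d i, Conn h e j} \<in> edges (blow_up k x) \<longleftrightarrow> g = x \<and> h = x \<and> d \<in> {1..k} \<and> e \<in> {1..k} \<and>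
    (d = e \<and> {i, j} \<in> {{1, 2}, {3, 4}} \<or> k = 1 \<and> {i, j} = {2, 3} \<or>
     i = 4 \<and> j = 1 \<and> e = cyclic_succ k d \<or> i = 1 \<and> j = 4 \<and> d = cyclic_succ k e)"
proof -
  consider "k = 1" | "k = 2" | "k \<ge> 3" using k_pos by linarith
  then show ?thesis
  proof cases
    case 1
    then show ?thesis
      by (auto simp: blow_up_def doubleton_eq_iff cyclic_succ_def)
  next
    case 2
    have [simp]: "{1..2} = {1, 2::nat}" by auto
    show ?thesis
      using 2 by (auto simp: blow_up_def doubleton_eq_iff cyclic_succ_def)
  next
    case 3
    then show ?thesis
      by (auto simp: blow_up_def doubleton_eq_iff)
  qed
qed

lemma blow_up_edge_Conn_Cent:
  "{Conn g d i, Cent h e j} \<in> edges (blow_up k x) \<longleftrightarrow> g = x \<and> h = x \<and> d \<in> {1..k} \<and> k \<ge> 2 \<and>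
    e = d \<and> i \<in> {2, 3} \<and> j = 1"
  by (auto simp: blow_up_def doubleton_eq_iff)

lemma blow_up_edge_Cent_Cent:
  "{Cent g d i, Cent h e j} \<in> edges (blow_up k x) \<longleftrightarrow> g = x \<and> h = x \<and> d \<in> {1..k} \<and> e \<in> {1..k} \<and>
    (k = 2 \<and> i = 1 \<and> j = 1 \<and> d \<noteq> e \<or> k \<ge> 3 \<and> d = e \<and> {i, j} = {1, 2} \<or>
     k \<ge> 3 \<and> i = 2 \<and> j = 2 \<and> (e = cyclic_succ k d \<or> d = cyclic_succ k e))"
  by (auto simp: blow_up_def doubleton_eq_iff)

lemma blow_up_edge_Chain: "{Chain d g h l, v} \<notin> edges (blow_up k x)"
  by (auto simp: blow_up_def doubleton_eq_iff)

lemma chain_edge_iff: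
  "{u, v} \<in> edges (chain d g h) \<longleftrightarrow>
    (\<exists>a b. u = Chain d g h a \<and> v = Chain d g h b \<and> {a, b} \<in> chain_label_edges d)"
proof
  assume "{u, v} \<in> edges (chain d g h)"
  then obtain e where e: "e \<in> chain_label_edges d" "{u, v} = Chain d g h ` e"
    by (auto simp: chain_def)
  moreover from e(1) obtain a b where ab: "e = {a, b}"
    unfolding chain_label_edges_def by blast
  ultimately have "u = Chain d g h a \<and> v = Chain d g h b \<or> u = Chain d g h b \<and> v = Chain d g h a"
    by (simp add: doubleton_eq_iff)
  moreover have "{a, b} \<in> chain_label_edges d" "{b, a} \<in> chain_label_edges d"
    using e(1) ab by (simp_all add: insert_commute)
  ultimately show "\<exists>a b. u = Chain d g h a \<and> v = Chain d g h b \<and> {a, b} \<in> chain_label_edges d"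
    by metis
next
  assume "\<exists>a b. u = Chain d g h a \<and> v = Chain d g h b \<and> {a, b} \<in> chain_label_edges d"
  then obtain a b where "{u, v} = Chain d g h ` {a, b}" "{a, b} \<in> chain_label_edges d"
    by auto
  then show "{u, v} \<in> edges (chain d g h)"
    unfolding chain_def by (metis image_eqI ugraph.select_convs(2))
qed

lemma edge_iff:
  "{u, v} \<in> E \<longleftrightarrow> (\<exists>g\<in>carrier G. {u, v} \<in> edges (blow_up k g)) \<or>
    (\<exists>d\<in>{1..k}. \<exists>g\<in>carrier G. {u, v} \<in> edges (chain d g (g \<otimes> s d)) \<or>
       {u, v} \<in> link_edges d g (g \<otimes> s d))"
  by (auto simp: D_graph_def cayley_edges_def)

lemma edge_Conn_Conn:
  "{Conn g d i, Conn h e j} \<in> E \<longleftrightarrow> g \<in> carrier G \<and> {Conn g d i, Conn h e j} \<in> edges (blow_up k g)"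
  unfolding edge_iff blow_up_edge_Conn_Conn
  by (auto simp: chain_edge_iff link_edges_def doubleton_eq_iff)

lemma edge_Conn_Cent:
  "{Conn g d i, Cent h e j} \<in> E \<longleftrightarrow> g \<in> carrier G \<and> {Conn g d i, Cent h e j} \<in> edges (blow_up k g)"
  unfolding edge_iff blow_up_edge_Conn_Cent
  by (auto simp: chain_edge_iff link_edges_def doubleton_eq_iff)

lemma edge_Cent_Cent:
  "{Cent g d i, Cent h e j} \<in> E \<longleftrightarrow> g \<in> carrier G \<and> {Cent g d i, Cent h e j} \<in> edges (blow_up k g)"
  unfolding edge_iff blow_up_edge_Cent_Cent
  by (auto simp: chain_edge_iff link_edges_def doubleton_eq_iff)

lemma edge_Chain_Conn:
  "{Chain d g h l, Conn x e i} \<in> E \<longleftrightarrow> d \<in> {1..k} \<and> g \<in> carrier G \<and> h = g \<otimes> s d \<and> e = d \<and>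
    (x = g \<and> (i = 1 \<and> l = U 1 \<or> i = 2 \<and> l = L 1) \<or> x = h \<and> (i = 4 \<and> l = N 6 \<or> i = 3 \<and> l = N 9))"
  unfolding edge_iff
  by (auto simp: chain_edge_iff link_edges_def doubleton_eq_iff blow_up_edge_Chain)

lemma edge_Chain_Cent: "{Chain d g h l, Cent x e i} \<notin> E"
  unfolding edge_iff
  by (auto simp: chain_edge_iff link_edges_def doubleton_eq_iff blow_up_edge_Chain)

lemma edge_Chain_Chain:
  "{Chain d g h a, Chain e x y b} \<in> E \<longleftrightarrow> d \<in> {1..k} \<and> g \<in> carrier G \<and> h = g \<otimes> s d \<and>
    e = d \<and> x = g \<and> y = h \<and> {a, b} \<in> chain_label_edges d"
  unfolding edge_iff
  by (auto simp: chain_edge_iff link_edges_def doubleton_eq_iff blow_up_edge_Chain)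

text \<open>Turns mixed pairs into the orientation in which the preceding rules are stated: chain
  vertices first, connectors before center vertices.\<close>

lemma edge_flip:
  "{Cent h e j, Conn g d i} \<in> E \<longleftrightarrow> {Conn g d i, Cent h e j} \<in> E"
  "{Conn x e i, Chain d g h l} \<in> E \<longleftrightarrow> {Chain d g h l, Conn x e i} \<in> E"
  "{Cent x e i, Chain d g h l} \<in> E \<longleftrightarrow> {Chain d g h l, Cent x e i} \<in> E"
  by (simp_all add: insert_commute)

lemmas edge_simps = edge_Conn_Conn edge_Conn_Cent edge_Cent_Cent edge_Chain_Conn edge_Chain_Cent
  edge_Chain_Chain edge_flip blow_up_edge_Conn_Conn blow_up_edge_Conn_Cent blow_up_edge_Cent_Cent

lemma edge_in_V:
  assumes "{u, v} \<in> E"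
  shows "u \<in> V"
proof (cases u)
  case [simp]: (Conn g d i)
  show ?thesis
    using assms by (cases v) (auto simp: Conn_in_V edge_simps doubleton_eq_iff)
next
  case [simp]: (Cent g d i)
  show ?thesis
    using assms by (cases v) (auto simp: Cent_in_V edge_simps doubleton_eq_iff)
next
  case [simp]: (Chain d g h l)
  show ?thesis
    using assms chain_label_edges_subset[of d]
    by (cases v) (auto simp: Chain_in_V edge_simps labels_def)
qed

section \<open>Neighbourhoods in the whole graph\<close>

definition nbr :: "'a vertex \<Rightarrow> 'a vertex set" where
  "nbr v = {w. {v, w} \<in> E}"

lemma nbr_commute: "w \<in> nbr v \<longleftrightarrow> v \<in> nbr w"
  by (simp add: nbr_def insert_commute)

lemma nbr_subset_V: "nbr v \<subseteq> V"
  using edge_in_V[of _ v] by (auto simp: nbr_def insert_commute)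

text \<open>The four exceptional labels are the ports of the chain: \<open>U 1\<close> and
  \<open>L 1\<close> lead to the blow-up at the tail \<open>g\<close>, \<open>N 6\<close> and
  \<open>N 9\<close> to the blow-up at the head \<open>h\<close>.\<close>

lemma nbr_Chain:
  assumes "g \<in> carrier G" "1 \<le> d" "d \<le> k" "h = g \<otimes> s d" "l \<in> labels d"
  shows "nbr (Chain d g h l) = Chain d g h ` label_nbr d l \<union>
    (if l = U 1 then {Conn g d 1} else if l = L 1 then {Conn g d 2}
     else if l = N 6 then {Conn h d 4} else if l = N 9 then {Conn h d 3} else {})"
    (is "_ = ?R")
proof (rule Set.set_eqI)
  fix w show "w \<in> nbr (Chain d g h l) \<longleftrightarrow> w \<in> ?R"
    using assms
    by (cases w) (auto simp: nbr_def edge_simps label_nbr_iff simp del: label_nbr.simps)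
qed

lemma s_cancel [simp]:
  assumes "g \<in> carrier G" "1 \<le> d" "d \<le> k"
  shows "g \<otimes> s d \<otimes> inv (s d) = g" "g \<otimes> inv (s d) \<otimes> s d = g"
  using assms by (simp_all add: m_assoc)

context
  fixes g d
  assumes g: "g \<in> carrier G" and d: "1 \<le> d" "d \<le> k"
begin

text \<open>Connectors 1 and 2 carry the outgoing chain of colour \<open>d\<close>, connectors 3 and
  4 the incoming one, which starts at \<open>g \<otimes> inv (s d)\<close>.\<close>

lemma nbr_Conn:
  "nbr (Conn g d 1) = {Conn g d 2, Chain d g (g \<otimes> s d) (U 1), Conn g (cyclic_pred k d) 4}"
  "nbr (Conn g d 2) = {Conn g d 1, Chain d g (g \<otimes> s d) (L 1), if k = 1 then Conn g d 3 else Cent g d 1}"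
  "nbr (Conn g d 3) = {Conn g d 4, Chain d (g \<otimes> inv (s d)) g (N 9), if k = 1 then Conn g d 2 else Cent g d 1}"
  "nbr (Conn g d 4) = {Conn g d 3, Chain d (g \<otimes> inv (s d)) g (N 6), Conn g (cyclic_succ k d) 1}"
proof -
  show "nbr (Conn g d 1) = {Conn g d 2, Chain d g (g \<otimes> s d) (U 1), Conn g (cyclic_pred k d) 4}"
  proof (rule Set.set_eqI)
    fix w show "w \<in> nbr (Conn g d 1) \<longleftrightarrow>
      w \<in> {Conn g d 2, Chain d g (g \<otimes> s d) (U 1), Conn g (cyclic_pred k d) 4}"
      using g d k_pos by (cases w) (auto simp: nbr_def edge_simps doubleton_eq_iff)
  qed
  show "nbr (Conn g d 2) = {Conn g d 1, Chain d g (g \<otimes> s d) (L 1), if k = 1 then Conn g d 3 else Cent g d 1}"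
  proof (rule Set.set_eqI)
    fix w show "w \<in> nbr (Conn g d 2) \<longleftrightarrow>
      w \<in> {Conn g d 1, Chain d g (g \<otimes> s d) (L 1), if k = 1 then Conn g d 3 else Cent g d 1}"
      using g d k_pos by (cases w) (auto simp: nbr_def edge_simps doubleton_eq_iff)
  qed
  show "nbr (Conn g d 3) = {Conn g d 4, Chain d (g \<otimes> inv (s d)) g (N 9), if k = 1 then Conn g d 2 else Cent g d 1}"
  proof (rule Set.set_eqI)
    fix w show "w \<in> nbr (Conn g d 3) \<longleftrightarrow>
      w \<in> {Conn g d 4, Chain d (g \<otimes> inv (s d)) g (N 9), if k = 1 then Conn g d 2 else Cent g d 1}"
      using g d k_pos by (cases w) (auto simp: nbr_def edge_simps doubleton_eq_iff)
  qed
  show "nbr (Conn g d 4) = {Conn g d 3, Chain d (g \<otimes> inv (s d)) g (N 6), Conn g (cyclic_succ k d) 1}"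
  proof (rule Set.set_eqI)
    fix w show "w \<in> nbr (Conn g d 4) \<longleftrightarrow>
      w \<in> {Conn g d 3, Chain d (g \<otimes> inv (s d)) g (N 6), Conn g (cyclic_succ k d) 1}"
      using g d k_pos by (cases w) (auto simp: nbr_def edge_simps doubleton_eq_iff)
  qed
qed

lemma nbr_Cent:
  "k \<ge> 2 \<Longrightarrow> nbr (Cent g d 1) = {Conn g d 2, Conn g d 3,
     if k = 2 then Cent g (cyclic_succ k d) 1 else Cent g d 2}"
  "k \<ge> 3 \<Longrightarrow> nbr (Cent g d 2) = {Cent g d 1, Cent g (cyclic_succ k d) 2, Cent g (cyclic_pred k d) 2}"
proof -
  show "nbr (Cent g d 1) = {Conn g d 2, Conn g d 3,
     if k = 2 then Cent g (cyclic_succ k d) 1 else Cent g d 2}" if "k \<ge> 2"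
  proof (rule Set.set_eqI)
    fix w show "w \<in> nbr (Cent g d 1) \<longleftrightarrow> w \<in> {Conn g d 2, Conn g d 3,
     if k = 2 then Cent g (cyclic_succ k d) 1 else Cent g d 2}"
      using g d that by (cases w) (auto simp: nbr_def edge_simps doubleton_eq_iff cyclic_succ_def)
  qed
  show "nbr (Cent g d 2) = {Cent g d 1, Cent g (cyclic_succ k d) 2, Cent g (cyclic_pred k d) 2}" if "k \<ge> 3"
  proof (rule Set.set_eqI)
    fix w show "w \<in> nbr (Cent g d 2) \<longleftrightarrow>
      w \<in> {Cent g d 1, Cent g (cyclic_succ k d) 2, Cent g (cyclic_pred k d) 2}"
      using g d that by (cases w) (auto simp: nbr_def edge_simps doubleton_eq_iff)
  qed
qed

end

subsection \<open>Triangles and houses\<close>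

abbreviation ch :: "nat \<Rightarrow> 'a \<Rightarrow> label \<Rightarrow> 'a vertex" where
  "ch d g \<equiv> Chain d g (g \<otimes> s d)"

lemma ch_in_V [simp]:
  "ch d g l \<in> V \<longleftrightarrow> g \<in> carrier G \<and> d \<in> {1..k} \<and> l \<in> labels d"
  by (auto simp: Chain_in_V)

lemma N_in_labels [simp]: "N i \<in> labels d \<longleftrightarrow> i \<le> 9"
  by (auto simp: labels_def)

lemma UL_in_labels [simp]:
  "U i \<in> labels d \<longleftrightarrow> 1 \<le> i \<and> i \<le> d" "L i \<in> labels d \<longleftrightarrow> 1 \<le> i \<and> i \<le> d"
  by (auto simp: labels_def)

text \<open>Label by label, two neighbours of a label are adjacent only within 0, 1, 3; the rungs of
  the ladder create squares but no triangles.\<close>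

lemma chain_triangle:
  assumes "{a, b} \<in> chain_label_edges d" "{a, c} \<in> chain_label_edges d" "{b, c} \<in> chain_label_edges d"
    "1 \<le> d"
  shows "{a, b, c} \<subseteq> {N 0, N 1, N 3}"
proof -
  have l: "a \<in> labels d" "b \<in> labels d"
    using assms chain_label_edges_subset by blast+
  then have n: "b \<in> label_nbr d a" "c \<in> label_nbr d a" "c \<in> label_nbr d b"
    using assms by (simp_all add: label_nbr_iff)
  show ?thesis
  proof (cases a)
    case (U i)
    with n l show ?thesis by (auto split: if_splits)
  next
    case (L i)
    with n l show ?thesis by (auto split: if_splits)
  next
    case (N i)
    with n l show ?thesis by (auto split: if_splits)
  qed
qed

text \<open>Lets the triangle lemmas ignore coinciding vertices. In the proof
  \<open>insert_absorb2\<close> is switched off because the edge rules match doubletons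
  only.\<close>

lemma no_loop: "{w, w} \<notin> E"
proof (cases w)
  case (Chain d g h l)
  then show ?thesis
    by (auto simp: edge_simps chain_label_edges_def doubleton_eq_iff simp del: insert_absorb2)
qed (auto simp: edge_simps cyclic_succ_def doubleton_eq_iff simp del: insert_absorb2 split: if_splits)

lemma nbrs_independent:
  assumes "nbr v = {a, b, c}" "{a, b} \<notin> E" "{a, c} \<notin> E" "{b, c} \<notin> E" "y \<in> nbr v" "z \<in> nbr v"
  shows "{y, z} \<notin> E"
  using assms no_loop by (auto simp: insert_commute)

text \<open>The three neighbours of a connector, one in a chain and two in the blow-up graph, are
  pairwise nonadjacent.\<close>

lemma no_triangle_Conn:
  assumes "{Conn g d i, y} \<in> E" "{Conn g d i, z} \<in> E"
  shows "{y, z} \<notin> E"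
proof -
  have g: "g \<in> carrier G" and d: "1 \<le> d" "d \<le> k" and "i \<in> {1..4}"
    using edge_in_V[OF assms(1)] by (auto simp: Conn_in_V)
  then have "i = 1 \<or> i = 2 \<or> i = 3 \<or> i = 4" by (auto simp: One_nat_def)
  moreover have "y \<in> nbr (Conn g d i)" "z \<in> nbr (Conn g d i)"
    using assms by (auto simp: nbr_def)
  ultimately show ?thesis
  proof (elim disjE)
    assume "i = 1"
    then show ?thesis using \<open>y \<in> _\<close> \<open>z \<in> _\<close>
      by (intro nbrs_independent[OF nbr_Conn(1)[OF g d], of y z]) (simp_all add: edge_simps doubleton_eq_iff)
  next
    assume i: "i = 2"
    \<comment> \<open>Naming the neighbour that depends on \<open>k\<close> keeps the conditional
      out of the neighbour set; nonadjacency holds for both of its values.\<close>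
    obtain w where w: "w = (if k = 1 then Conn g d 3 else Cent g d 1)" by blast
    then have "w = Conn g d 3 \<or> w = Cent g d 1" by auto
    then show ?thesis using i \<open>y \<in> _\<close> \<open>z \<in> _\<close>
      by (intro nbrs_independent[OF nbr_Conn(2)[OF g d, folded w], of y z])
        (auto simp: edge_simps doubleton_eq_iff)
  next
    assume i: "i = 3"
    obtain w where w: "w = (if k = 1 then Conn g d 2 else Cent g d 1)" by blast
    then have "w = Conn g d 2 \<or> w = Cent g d 1" by auto
    then show ?thesis using i \<open>y \<in> _\<close> \<open>z \<in> _\<close>
      by (intro nbrs_independent[OF nbr_Conn(3)[OF g d, folded w], of y z])
        (auto simp: edge_simps doubleton_eq_iff)
  next
    assume "i = 4"
    then show ?thesis using \<open>y \<in> _\<close> \<open>z \<in> _\<close>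
      by (intro nbrs_independent[OF nbr_Conn(4)[OF g d], of y z]) (simp_all add: edge_simps doubleton_eq_iff)
  qed
qed

lemma no_triangle_Cent:
  assumes "{Cent g d 1, y} \<in> E" "{Cent g d 1, z} \<in> E"
  shows "{y, z} \<notin> E"
proof
  assume yz: "{y, z} \<in> E"
  have g: "g \<in> carrier G" and d: "1 \<le> d" "d \<le> k" and k: "2 \<le> k"
    using edge_in_V[OF assms(1)] by (auto simp: Cent_in_V)
  have nc: "y \<noteq> Conn h e j" "z \<noteq> Conn h e j" for h e j
    using no_triangle_Conn[of h e j "Cent g d 1" z] no_triangle_Conn[of h e j "Cent g d 1" y]
      assms yz by (auto simp: insert_commute)
  have "y \<in> nbr (Cent g d 1)" "z \<in> nbr (Cent g d 1)"
    using assms by (auto simp: nbr_def)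
  \<comment> \<open>Two of the three neighbours are connectors, which lie in no triangle, so only
    one candidate is left for both \<open>y\<close> and \<open>z\<close>.\<close>
  then have "y = z"
    using g d k nc by (auto simp: nbr_Cent)
  with yz show False
    using no_loop by simp
qed

text \<open>Connectors and first center vertices lie in no triangle, and chains are never adjacent
  to center vertices. What remains are triangles within one chain and triangles of second center
  vertices; the latter form a cycle of length \<open>k\<close>, so these occur for
  \<open>k = 3\<close>.\<close>

lemma triangle:
  assumes "{x, y} \<in> E" "{x, z} \<in> E" "{y, z} \<in> E"
  obtains (chain) d g where "1 \<le> d" "d \<le> k" "g \<in> carrier G" "{x, y, z} \<subseteq> ch d g ` {N 0, N 1, N 3}"
  | (center) g d e f where "k \<ge> 3" "x = Cent g d 2" "y = Cent g e 2" "z = Cent g f 2"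
      "g \<in> carrier G" "{d, e, f} \<subseteq> {1..k}"
      "e = cyclic_succ k d \<or> d = cyclic_succ k e" "f = cyclic_succ k d \<or> d = cyclic_succ k f"
      "f = cyclic_succ k e \<or> e = cyclic_succ k f"
proof -
  have sym: "{y, x} \<in> E" "{z, x} \<in> E" "{z, y} \<in> E"
    using assms by (simp_all add: insert_commute)
  have no_Conn: "x \<noteq> Conn h j i" "y \<noteq> Conn h j i" "z \<noteq> Conn h j i" for h j i
    using no_triangle_Conn[of h j i y z] no_triangle_Conn[of h j i x z] no_triangle_Conn[of h j i x y]
      assms sym by blast+
  have no_Cent: "x \<noteq> Cent h j 1" "y \<noteq> Cent h j 1" "z \<noteq> Cent h j 1" for h j
    using no_triangle_Cent[of h j y z] no_triangle_Cent[of h j x z] no_triangle_Cent[of h j x y]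
      assms sym by blast+
  show thesis
  proof (cases x)
    case (Conn g d i)
    with no_Conn(1) show thesis by blast
  next
    case x: (Cent g d i)
    have "i \<noteq> 1" using no_Cent(1) x by blast
    then have i: "i = 2" using edge_in_V[OF assms(1)] x by (auto simp: Cent_in_V)
    have "\<exists>e. y = Cent g e 2"
      using assms(1) no_Conn(2) no_Cent(2) x i
      by (cases y) (auto simp: edge_simps doubleton_eq_iff)
    moreover have "\<exists>e. z = Cent g e 2"
      using assms(2) no_Conn(3) no_Cent(3) x i
      by (cases z) (auto simp: edge_simps doubleton_eq_iff)
    ultimately obtain e f where "y = Cent g e 2" "z = Cent g f 2" by blast
    with x i assms show thesis
      by (intro center[of g d e f]) (auto simp: edge_simps doubleton_eq_iff)
  next
    case x: (Chain d g h a)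
    obtain b where y: "y = Chain d g h b"
      using assms(1) no_Conn(2) x by (cases y) (auto simp: edge_simps)
    obtain c where z: "z = Chain d g h c"
      using assms(2) no_Conn(3) x by (cases z) (auto simp: edge_simps)
    have "g \<in> carrier G" "1 \<le> d" "d \<le> k" "h = g \<otimes> s d"
      "{a, b} \<in> chain_label_edges d" "{a, c} \<in> chain_label_edges d" "{b, c} \<in> chain_label_edges d"
      using assms x y z by (auto simp: edge_simps)
    with chain_triangle[of a b d c] x y z show thesis
      by (intro chain[of d g]) auto
  qed
qed

text \<open>A cycle of length at least 3 contains three mutually adjacent points only if its length
  is 3, and then these are all its points.\<close>

lemma cyclic_triangle:
  assumes "k \<ge> 3" "{d, e, f} \<subseteq> {1..k}"
    "e = cyclic_succ k d \<or> d = cyclic_succ k e" "f = cyclic_succ k d \<or> d = cyclic_succ k f"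
    "f = cyclic_succ k e \<or> e = cyclic_succ k f"
  shows "{d, e, f} = {1..k}"
proof -
  from assms have "k = 3" and *: "d \<noteq> e" "d \<noteq> f" "e \<noteq> f"
    by (auto simp: cyclic_succ_def split: if_splits)
  then have "d = 1 \<or> d = 2 \<or> d = 3" "e = 1 \<or> e = 2 \<or> e = 3" "f = 1 \<or> f = 2 \<or> f = 3"
    using assms(2) by auto
  moreover have "{1..3} = {1, 2, 3::nat}" by auto
  ultimately show ?thesis
    using * \<open>k = 3\<close> by (elim disjE) auto
qed

text \<open>Where a set is fed to \<open>third_nbr\<close>, the neighbour to be determined stands
  last.\<close>

lemma nbr_N:
  assumes "g \<in> carrier G" "1 \<le> d" "d \<le> k"
  shows "nbr (ch d g (N 0)) = {ch d g (N 1), ch d g (N 2), ch d g (N 3)}"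
    "nbr (ch d g (N 1)) = {ch d g (N 0), ch d g (N 3), ch d g (N 6)}"
    "nbr (ch d g (N 2)) = {ch d g (N 0), ch d g (N 5), ch d g (N 4)}"
    "nbr (ch d g (N 3)) = {ch d g (N 0), ch d g (N 1), ch d g (N 5)}"
    "nbr (ch d g (N 4)) = {ch d g (N 2), ch d g (N 7), ch d g (U d)}"
    "nbr (ch d g (N 5)) = {ch d g (N 2), ch d g (N 3), ch d g (N 8)}"
    "nbr (ch d g (N 6)) = {ch d g (N 1), ch d g (N 9), Conn (g \<otimes> s d) d 4}"
    "nbr (ch d g (N 7)) = {ch d g (N 4), ch d g (N 8), ch d g (L d)}"
    "nbr (ch d g (N 8)) = {ch d g (N 5), ch d g (N 7), ch d g (N 9)}"
    "nbr (ch d g (N 9)) = {ch d g (N 6), ch d g (N 8), Conn (g \<otimes> s d) d 3}"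
  using assms by (auto simp: nbr_Chain)

text \<open>\<open>x\<close> is the tip of the roof, \<open>y\<close> and \<open>z\<close> are the
  other corners of the triangle, \<open>p\<close> and \<open>q\<close> the feet below them. As there
  are no loops, the inequalities place both feet outside the triangle.\<close>

definition house :: "'a vertex \<Rightarrow> 'a vertex \<Rightarrow> 'a vertex \<Rightarrow> 'a vertex \<Rightarrow> 'a vertex \<Rightarrow> bool" where
  "house x y z p q \<longleftrightarrow> y \<in> nbr x \<and> z \<in> nbr x \<and> z \<in> nbr y \<and> p \<in> nbr y \<and> q \<in> nbr z \<and> q \<in> nbr p \<and>
     p \<noteq> x \<and> p \<noteq> z \<and> q \<noteq> x \<and> q \<noteq> y"

lemma house_ch:
  assumes "g \<in> carrier G" "1 \<le> d" "d \<le> k"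
  shows "house (ch d g (N 1)) (ch d g (N 0)) (ch d g (N 3)) (ch d g (N 2)) (ch d g (N 5))"
  using assms by (simp add: house_def nbr_N)

text \<open>In a chain the triangle has labels 0, 1, 3, whose outer neighbours are 2, 6, 5; only 2
  and 5 are adjacent, so the tip is 1 and just the reflection remains open. A triangle of center
  vertices carries no house, since its outer neighbours are nonadjacent.\<close>

lemma houseD:
  assumes "house x y z p q"
  obtains d g where "1 \<le> d" "d \<le> k" "g \<in> carrier G" "x = ch d g (N 1)"
    "y = ch d g (N 0) \<and> z = ch d g (N 3) \<and> p = ch d g (N 2) \<and> q = ch d g (N 5) \<or>
     y = ch d g (N 3) \<and> z = ch d g (N 0) \<and> p = ch d g (N 5) \<and> q = ch d g (N 2)"
proof -
  have h: "y \<in> nbr x" "z \<in> nbr x" "z \<in> nbr y" "p \<in> nbr y" "q \<in> nbr z" "q \<in> nbr p"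
    "p \<noteq> x" "p \<noteq> z" "q \<noteq> x" "q \<noteq> y"
    using assms by (auto simp: house_def)
  have "{x, y} \<in> E" "{x, z} \<in> E" "{y, z} \<in> E"
    using h by (auto simp: nbr_def)
  then show thesis
  proof (cases rule: triangle)
    case (chain d g)
    then have "x \<in> ch d g ` {N 0, N 1, N 3}" by simp
    then have "x = ch d g (N 1) \<and>
      (y = ch d g (N 0) \<and> z = ch d g (N 3) \<and> p = ch d g (N 2) \<and> q = ch d g (N 5) \<or>
       y = ch d g (N 3) \<and> z = ch d g (N 0) \<and> p = ch d g (N 5) \<and> q = ch d g (N 2))"
      using h chain by (auto simp: nbr_N)
    with chain(1-3) that show thesis by blast
  next
    case (center g d e f)
    have "p \<in> {Cent g e 1, Cent g (cyclic_succ k e) 2, Cent g (cyclic_pred k e) 2}"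
      "q \<in> {Cent g f 1, Cent g (cyclic_succ k f) 2, Cent g (cyclic_pred k f) 2}"
      using h center(1-6) by (auto simp: nbr_Cent)
    moreover have "1 \<le> e" "e \<le> k" "1 \<le> f" "f \<le> k"
      using center(6) by auto
    \<comment> \<open>The triangle uses up all colours, so the cyclic neighbours are corners of it
      and cannot be feet; the feet are first center vertices.\<close>
    then have "cyclic_succ k e \<in> {d, e, f}" "cyclic_pred k e \<in> {d, e, f}"
      "cyclic_succ k f \<in> {d, e, f}" "cyclic_pred k f \<in> {d, e, f}"
      unfolding cyclic_triangle[OF center(1,6-9)] by auto
    moreover have "cyclic_succ k e \<noteq> e" "cyclic_pred k e \<noteq> e" "cyclic_succ k f \<noteq> f" "cyclic_pred k f \<noteq> f"
      using center(1) by (auto simp: cyclic_succ_def cyclic_pred_def)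
    ultimately have "p = Cent g e 1" "q = Cent g f 1"
      using h center(2-4) by auto
    with h center(1,5,6) show thesis by (auto simp: nbr_Cent split: if_splits)
  qed
qed

subsection \<open>Ladders\<close>

text \<open>
  The two rails of the ladder of a chain, prolonged at both ends: rung \<open>i\<close> joins \<open>u_(i-1)\<close> and
  \<open>l_(i-1)\<close> for \<open>2 \<le> i \<le> d + 1\<close>, rung \<open>d + 2\<close> joins \<open>4\<close> and \<open>7\<close>, rung \<open>1\<close> joins the first two
  connectors, and for \<open>k \<ge> 2\<close> there is no rung at index \<open>0\<close>.
\<close>

definition urail :: "nat \<Rightarrow> 'a \<Rightarrow> nat \<Rightarrow> 'a vertex" where
  "urail d g i = (if i = 0 then Conn g (cyclic_pred k d) 4 else if i = 1 then Conn g d 1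
     else if i \<le> d + 1 then ch d g (U (i - 1)) else ch d g (N 4))"

definition lrail :: "nat \<Rightarrow> 'a \<Rightarrow> nat \<Rightarrow> 'a vertex" where
  "lrail d g i = (if i = 0 then if k = 1 then Conn g d 3 else Cent g d 1 else if i = 1 then Conn g d 2
     else if i \<le> d + 1 then ch d g (L (i - 1)) else ch d g (N 7))"

text \<open>This uniform shape, valid at the indices \<open>1\<close> to \<open>d + 1\<close>, is
  the purpose of prolonging the rails. The lower rail vertex stands last because it is the one that
  \<open>third_nbr\<close> will determine.\<close>

lemma nbr_urail:
  assumes "g \<in> carrier G" "1 \<le> d" "d \<le> k" "i \<le> d"
  shows "nbr (urail d g (i + 1)) = {lrail d g (i + 1), urail d g (i + 2), urail d g i}"
proof (cases "i = 0")
  case True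
  then show ?thesis using assms by (auto simp: urail_def lrail_def nbr_Conn)
next
  case False
  then show ?thesis using assms
    by (auto simp: urail_def lrail_def nbr_Chain)
qed

lemma nbr_lrail:
  assumes "g \<in> carrier G" "1 \<le> d" "d \<le> k" "i \<le> d"
  shows "nbr (lrail d g (i + 1)) = {urail d g (i + 1), lrail d g (i + 2), lrail d g i}"
proof (cases "i = 0")
  case True
  then show ?thesis using assms by (auto simp: urail_def lrail_def nbr_Conn)
next
  case False
  then show ?thesis using assms
    by (auto simp: urail_def lrail_def nbr_Chain)
qed

text \<open>Supplies the inequalities for \<open>third_nbr\<close>. Both rails are constant from
  index \<open>d + 2\<close> on, hence the escape \<open>i > d\<close>.\<close>

lemma rail_distinct:
  "urail d g i \<noteq> lrail d g j" "lrail d g j \<noteq> urail d g i"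
  "urail d g i \<noteq> urail d g (i + 2) \<or> i > d" "lrail d g i \<noteq> lrail d g (i + 2) \<or> i > d"
  by (auto simp: urail_def lrail_def)

lemma rail_in_V:
  assumes "g \<in> carrier G" "1 \<le> d" "d \<le> k"
  shows "urail d g i \<in> V" "lrail d g i \<in> V"
proof -
  show "urail d g i \<in> V"
    using assms by (auto simp: urail_def Conn_in_V)
  have "lrail d g 0 \<in> V"
  proof (cases "k = 1")
    case True
    then have "lrail d g 0 = Conn g d 3" unfolding lrail_def by simp
    then show ?thesis using assms by (simp add: Conn_in_V)
  next
    case False
    with assms show ?thesis by (simp add: lrail_def Cent_in_V)
  qed
  moreover have "lrail d g i \<in> V" if "i \<noteq> 0"
    using assms that by (auto simp: lrail_def Conn_in_V)
  ultimately show "lrail d g i \<in> V" by (cases "i = 0") simp_all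
qed

text \<open>At index 0 stand connector 4 of the preceding colour and a first center vertex, which
  are not adjacent. For \<open>k = 1\<close> they would be connectors 4 and 3, which are adjacent;
  hence \<open>k \<ge> 2\<close>.\<close>

lemma rung_iff:
  assumes "g \<in> carrier G" "1 \<le> d" "d \<le> k" "i \<le> d + 2" "k \<ge> 2"
  shows "{urail d g i, lrail d g i} \<in> E \<longleftrightarrow> i \<noteq> 0"
proof (cases "i = 0")
  case True
  then show ?thesis
    using assms by (auto simp: urail_def lrail_def edge_simps)
next
  case False
  then have "lrail d g i \<in> nbr (urail d g i)"
  proof (cases "i = d + 2")
    case True
    then show ?thesis using assms by (simp add: urail_def lrail_def nbr_N)
  next
    case False
    with \<open>i \<noteq> 0\<close> assms nbr_urail[of g d "i - 1"] show ?thesis by auto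
  qed
  with False show ?thesis by (auto simp: nbr_def)
qed

end

section \<open>The action of an automorphism on a chain\<close>

locale blow_up_aut = cayley_blow_up +
  fixes f
  assumes aut: "f \<in> graph_aut (D_graph G k s)"
begin

lemma bij: "bij_betw f V V"
  using aut by (auto simp: graph_aut_def Bij_def)

lemma f_eq_iff: "u \<in> V \<Longrightarrow> v \<in> V \<Longrightarrow> f u = f v \<longleftrightarrow> u = v"
  using bij by (auto simp: bij_betw_def inj_on_def)

lemma f_edge: "u \<in> V \<Longrightarrow> v \<in> V \<Longrightarrow> {f u, f v} \<in> E \<longleftrightarrow> {u, v} \<in> E"
  using aut by (auto simp: graph_aut_def)

lemma nbr_f:
  assumes "v \<in> V"
  shows "nbr (f v) = f ` nbr v"
proof
  show "f ` nbr v \<subseteq> nbr (f v)"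
    using assms nbr_subset_V[of v] f_edge by (auto simp: nbr_def)
  show "nbr (f v) \<subseteq> f ` nbr v"
  proof
    fix w assume w: "w \<in> nbr (f v)"
    then have "w \<in> V" using nbr_subset_V by blast
    then obtain u where "u \<in> V" "w = f u"
      using bij by (auto simp: bij_betw_def)
    with w assms f_edge show "w \<in> f ` nbr v" by (auto simp: nbr_def)
  qed
qed

text \<open>\<open>f\<close> maps the neighbours of \<open>v\<close> onto those of
  \<open>v'\<close>, so \<open>c'\<close> is the image of \<open>a\<close>, \<open>b\<close> or
  \<open>c\<close>, and the first two are already sent elsewhere. This is the propagation rule for
  most values of \<open>f\<close> below.\<close>

lemma third_nbr:
  assumes "v \<in> V" "nbr v = {a, b, c}" "f v = v'" "f a = a'" "f b = b'" "c' \<in> nbr v'"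
    "c' \<noteq> a'" "c' \<noteq> b'"
  shows "f c = c'"
proof -
  have "c' \<in> f ` {a, b, c}"
    using nbr_f[OF assms(1)] assms(2,3,6) by simp
  then show ?thesis
    using assms(4,5,7,8) by auto
qed

lemma f_nbr: "v \<in> V \<Longrightarrow> w \<in> nbr v \<Longrightarrow> f w \<in> nbr (f v)"
  by (simp add: nbr_f)

lemma nbr_in_V: "w \<in> nbr v \<Longrightarrow> v \<in> V \<and> w \<in> V"
  using nbr_subset_V nbr_commute by blast

lemma house_f:
  assumes "house x y z p q"
  shows "house (f x) (f y) (f z) (f p) (f q)"
proof -
  have V: "x \<in> V" "y \<in> V" "z \<in> V" "p \<in> V" "q \<in> V"
    using assms nbr_in_V unfolding house_def by (metis (no_types))+
  with assms show ?thesis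
    by (simp add: house_def nbr_f f_eq_iff)
qed

text \<open>The image of the house selects the image chain, and the other values spread from it. The
  colour \<open>d'\<close> stays open here, because the numbered labels form the same graph in
  chains of every colour.\<close>

lemma f_chain_N:
  assumes g: "g \<in> carrier G" and d: "1 \<le> d" "d \<le> k"
  obtains g' d' where "g' \<in> carrier G" "1 \<le> d'" "d' \<le> k"
    "\<And>i. i \<le> 9 \<Longrightarrow> f (ch d g (N i)) = ch d' g' (N i)"
    "f (ch d g (U d)) = ch d' g' (U d')" "f (ch d g (L d)) = ch d' g' (L d')"
    "f (Conn (g \<otimes> s d) d 4) = Conn (g' \<otimes> s d') d' 4"
    "f (Conn (g \<otimes> s d) d 3) = Conn (g' \<otimes> s d') d' 3"
proof -
  have V: "ch d g (N i) \<in> V" if "i \<le> 9" for i using g d that by simp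
  obtain d' g' where d': "1 \<le> d'" "d' \<le> k" and g': "g' \<in> carrier G"
    and f1: "f (ch d g (N 1)) = ch d' g' (N 1)"
    and or: "f (ch d g (N 0)) = ch d' g' (N 0) \<and> f (ch d g (N 3)) = ch d' g' (N 3) \<and>
        f (ch d g (N 2)) = ch d' g' (N 2) \<and> f (ch d g (N 5)) = ch d' g' (N 5) \<or>
      f (ch d g (N 0)) = ch d' g' (N 3) \<and> f (ch d g (N 3)) = ch d' g' (N 0) \<and>
        f (ch d g (N 2)) = ch d' g' (N 5) \<and> f (ch d g (N 5)) = ch d' g' (N 2)"
    using houseD[OF house_f[OF house_ch[OF g d]]] by metis
  note N = nbr_N[OF g d] and N' = nbr_N[OF g' d']
  note third = third_nbr[OF V]
  from or have "f (ch d g (N 0)) = ch d' g' (N 0) \<and> f (ch d g (N 3)) = ch d' g' (N 3) \<and>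
        f (ch d g (N 2)) = ch d' g' (N 2) \<and> f (ch d g (N 5)) = ch d' g' (N 5)"
  proof
    txt \<open>The reflection of the house swaps the neighbours \<open>4\<close> and \<open>8\<close> of its feet and fixes \<open>7\<close>,
      but the third neighbours of \<open>4\<close> and \<open>7\<close> are adjacent and those of \<open>8\<close> and \<open>7\<close> are not.\<close>
    assume "f (ch d g (N 0)) = ch d' g' (N 3) \<and> f (ch d g (N 3)) = ch d' g' (N 0) \<and>
        f (ch d g (N 2)) = ch d' g' (N 5) \<and> f (ch d g (N 5)) = ch d' g' (N 2)"
    then have f0: "f (ch d g (N 0)) = ch d' g' (N 3)" and f3: "f (ch d g (N 3)) = ch d' g' (N 0)"
      and f2: "f (ch d g (N 2)) = ch d' g' (N 5)" and f5: "f (ch d g (N 5)) = ch d' g' (N 2)"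
      by auto
    have f4: "f (ch d g (N 4)) = ch d' g' (N 8)"
      by (rule third[OF _ N(3) f2 f0 f5]) (simp_all add: N')
    have f8: "f (ch d g (N 8)) = ch d' g' (N 4)"
      by (rule third[OF _ N(6) f5 f2 f3]) (simp_all add: N')
    have "f (ch d g (N 7)) \<in> nbr (f (ch d g (N 4)))" "f (ch d g (N 7)) \<in> nbr (f (ch d g (N 8)))"
      by (rule f_nbr[OF V]; simp add: N)+
    then have f7: "f (ch d g (N 7)) = ch d' g' (N 7)"
      by (auto simp: f4 f8 N')
    have fU: "f (ch d g (U d)) = ch d' g' (N 9)"
      by (rule third[OF _ N(5) f4 f2 f7]) (simp_all add: N')
    have fL: "f (ch d g (L d)) = ch d' g' (L d')"
      by (rule third[OF _ N(8) f7 f4 f8]) (simp_all add: N')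
    have "{ch d g (U d), ch d g (L d)} \<in> E"
      using g d by (auto simp: edge_simps label_nbr_iff)
    then have "{ch d' g' (N 9), ch d' g' (L d')} \<in> E"
      using f_edge[of "ch d g (U d)" "ch d g (L d)"] g d fU fL by auto
    then show ?thesis
      using g' d' by (auto simp: edge_simps label_nbr_iff)
  qed auto
  then have f0: "f (ch d g (N 0)) = ch d' g' (N 0)" and f3: "f (ch d g (N 3)) = ch d' g' (N 3)"
    and f2: "f (ch d g (N 2)) = ch d' g' (N 2)" and f5: "f (ch d g (N 5)) = ch d' g' (N 5)"
    by auto
  have f4: "f (ch d g (N 4)) = ch d' g' (N 4)"
    by (rule third[OF _ N(3) f2 f0 f5]) (simp_all add: N')
  have f8: "f (ch d g (N 8)) = ch d' g' (N 8)"
    by (rule third[OF _ N(6) f5 f2 f3]) (simp_all add: N')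
  have f6: "f (ch d g (N 6)) = ch d' g' (N 6)"
    by (rule third[OF _ N(2) f1 f0 f3]) (simp_all add: N')
  \<comment> \<open>Only one neighbour of 4 and one of 8 have known images, so
    \<open>third_nbr\<close> does not apply yet; but 7 is the only common neighbour of 4 and
    8.\<close>
  have "f (ch d g (N 7)) \<in> nbr (f (ch d g (N 4)))" "f (ch d g (N 7)) \<in> nbr (f (ch d g (N 8)))"
    by (rule f_nbr[OF V]; simp add: N)+
  then have f7: "f (ch d g (N 7)) = ch d' g' (N 7)"
    by (auto simp: f4 f8 N')
  have f9: "f (ch d g (N 9)) = ch d' g' (N 9)"
    by (rule third[OF _ N(9) f8 f5 f7]) (simp_all add: N')
  show thesis
  proof (rule that[OF g' d'])
    fix i :: nat assume "i \<le> 9"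
    then have "i \<in> {0..9}" by simp
    then have "i = 0 \<or> i = 1 \<or> i = 2 \<or> i = 3 \<or> i = 4 \<or> i = 5 \<or> i = 6 \<or> i = 7 \<or> i = 8 \<or> i = 9"
      by (auto simp: One_nat_def)
    with f0 f1 f2 f3 f4 f5 f6 f7 f8 f9 show "f (ch d g (N i)) = ch d' g' (N i)"
      by (elim disjE) simp_all
  next
    show "f (ch d g (U d)) = ch d' g' (U d')"
      by (rule third[OF _ N(5) f4 f2 f7]) (simp_all add: N')
    show "f (ch d g (L d)) = ch d' g' (L d')"
      by (rule third[OF _ N(8) f7 f4 f8]) (simp_all add: N')
    show "f (Conn (g \<otimes> s d) d 4) = Conn (g' \<otimes> s d') d' 4"
      by (rule third[OF _ N(7) f6 f1 f9]) (simp_all add: N')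
    show "f (Conn (g \<otimes> s d) d 3) = Conn (g' \<otimes> s d') d' 3"
      by (rule third[OF _ N(10) f9 f6 f8]) (simp_all add: N')
  qed
qed

text \<open>Counting from the house end aligns two ladders of possibly different length. The
  invariant covers two consecutive rungs, since \<open>third_nbr\<close> needs the rung partner and
  the vertex above; the bounds on \<open>j\<close> stop at index 0 of the shorter ladder.\<close>

lemma f_rail:
  assumes g: "g \<in> carrier G" "1 \<le> d" "d \<le> k" and g': "g' \<in> carrier G" "1 \<le> d'" "d' \<le> k"
    and 4: "f (ch d g (N 4)) = ch d' g' (N 4)" "f (ch d g (N 7)) = ch d' g' (N 7)"
    and U: "f (ch d g (U d)) = ch d' g' (U d')" "f (ch d g (L d)) = ch d' g' (L d')"
    and "j \<le> d + 1" "j \<le> d' + 1"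
  shows "f (urail d g (d + 2 - j)) = urail d' g' (d' + 2 - j) \<and>
    f (lrail d g (d + 2 - j)) = lrail d' g' (d' + 2 - j) \<and>
    f (urail d g (d + 1 - j)) = urail d' g' (d' + 1 - j) \<and>
    f (lrail d g (d + 1 - j)) = lrail d' g' (d' + 1 - j)"
  using assms(11-12)
proof (induction j)
  case 0
  show ?case
    using 4 U g g' by (simp add: urail_def lrail_def)
next
  case (Suc j)
  \<comment> \<open>The index to be reached. The subtraction is exact, as
    \<open>Suc j \<le> d + 1\<close>.\<close>
  define i where "i = d - j"
  define i' where "i' = d' - j"
  have i: "i \<le> d" "d + 2 - j = i + 2" "d + 1 - j = i + 1" "d + 1 - Suc j = i" "d + 2 - Suc j = i + 1"
    and i': "i' \<le> d'" "d' + 2 - j = i' + 2" "d' + 1 - j = i' + 1" "d' + 1 - Suc j = i'" "d' + 2 - Suc j = i' + 1"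
    using Suc.prems by (auto simp: i_def i'_def)
  have IH: "f (urail d g (i + 2)) = urail d' g' (i' + 2)"
    "f (lrail d g (i + 2)) = lrail d' g' (i' + 2)"
    "f (urail d g (i + 1)) = urail d' g' (i' + 1)"
    "f (lrail d g (i + 1)) = lrail d' g' (i' + 1)"
    using Suc.IH[unfolded i(2,3) i'(2,3)] Suc.prems by simp_all
  have "f (urail d g i) = urail d' g' i'"
    by (rule third_nbr[OF rail_in_V(1)[OF g] nbr_urail[OF g i(1)] IH(3,4,1)])
      (use rail_distinct[of d' g' i'] i'(1) in \<open>auto simp: nbr_urail[OF g' i'(1)]\<close>)
  moreover have "f (lrail d g i) = lrail d' g' i'"
    by (rule third_nbr[OF rail_in_V(2)[OF g] nbr_lrail[OF g i(1)] IH(4,3,2)])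
      (use rail_distinct[of d' g' i'] i'(1) in \<open>auto simp: nbr_lrail[OF g' i'(1)]\<close>)
  ultimately show ?case
    using IH by (simp only: i i')
qed

text \<open>Different colours would align a missing rung of the shorter ladder with a rung of the
  longer one. Two colours exist only for \<open>k \<ge> 2\<close>, where \<open>rung_iff\<close>
  applies.\<close>

lemma f_chain:
  assumes g: "g \<in> carrier G" "1 \<le> d" "d \<le> k"
  obtains g' where "g' \<in> carrier G"
    "\<And>i. i \<le> 9 \<Longrightarrow> f (ch d g (N i)) = ch d g' (N i)"
    "\<And>i. i \<le> d + 2 \<Longrightarrow> f (urail d g i) = urail d g' i"
    "\<And>i. i \<le> d + 2 \<Longrightarrow> f (lrail d g i) = lrail d g' i"
    "f (Conn (g \<otimes> s d) d 4) = Conn (g' \<otimes> s d) d 4"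
    "f (Conn (g \<otimes> s d) d 3) = Conn (g' \<otimes> s d) d 3"
proof -
  obtain g' d' where g': "g' \<in> carrier G" "1 \<le> d'" "d' \<le> k"
    and N: "\<And>i. i \<le> 9 \<Longrightarrow> f (ch d g (N i)) = ch d' g' (N i)"
    and UL: "f (ch d g (U d)) = ch d' g' (U d')" "f (ch d g (L d)) = ch d' g' (L d')"
    and C: "f (Conn (g \<otimes> s d) d 4) = Conn (g' \<otimes> s d') d' 4"
    "f (Conn (g \<otimes> s d) d 3) = Conn (g' \<otimes> s d') d' 3"
    using f_chain_N[OF g] by metis
  have rail: "f (urail d g (d + 1 - j)) = urail d' g' (d' + 1 - j)"
    "f (lrail d g (d + 1 - j)) = lrail d' g' (d' + 1 - j)"
    "f (urail d g (d + 2 - j)) = urail d' g' (d' + 2 - j)"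
    "f (lrail d g (d + 2 - j)) = lrail d' g' (d' + 2 - j)" if "j \<le> d + 1" "j \<le> d' + 1" for j
    using f_rail[OF g g' N N UL that] by auto
  have "d = d'"
  proof (rule ccontr)
    assume "d \<noteq> d'"
    then have k: "k \<ge> 2" using g g' by linarith
    \<comment> \<open>This \<open>j\<close> leads to index 0 in the shorter ladder and to a positive
      index in the longer one.\<close>
    define j where "j = min d d' + 1"
    have j: "j \<le> d + 1" "j \<le> d' + 1" by (auto simp: j_def)
    have "{urail d g (d + 1 - j), lrail d g (d + 1 - j)} \<in> E \<longleftrightarrow>
      {urail d' g' (d' + 1 - j), lrail d' g' (d' + 1 - j)} \<in> E"
      using f_edge[OF rail_in_V[OF g]] rail(1,2)[OF j] by metis
    then have "d + 1 - j \<noteq> 0 \<longleftrightarrow> d' + 1 - j \<noteq> 0"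
      using rung_iff[OF g _ k, of "d + 1 - j"] rung_iff[OF g' _ k, of "d' + 1 - j"] by simp
    with \<open>d \<noteq> d'\<close> show False by (auto simp: j_def)
  qed
  have "f (urail d g i) = urail d g' i \<and> f (lrail d g i) = lrail d g' i" if "i \<le> d + 2" for i
  proof (cases "i = d + 2")
    case True
    then show ?thesis using rail(3,4)[of 0] \<open>d = d'\<close> by simp
  next
    case False
    then show ?thesis using rail(1,2)[of "d + 1 - i"] \<open>d = d'\<close> that by simp
  qed
  then show thesis
    using that[of g'] g' N C \<open>d = d'\<close> by simp
qed

subsection \<open>From automorphisms to translations\<close>

text \<open>\<open>F d g\<close> is the tail of the image of the chain of colour \<open>d\<close>
  leaving \<open>g\<close>. It does not depend on \<open>d\<close> and commutes with right
  multiplication by the generators, hence is left multiplication by its value at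
  \<open>\<one>\<close>.\<close>

lemma f_eq_translation:
  obtains x where "x \<in> carrier G" "\<And>v. v \<in> V \<Longrightarrow> f v = map_vertex (\<lambda>g. x \<otimes> g) v"
proof -
  \<comment> \<open>\<open>Q\<close> bundles all conclusions of \<open>f_chain\<close>, so that one
    choice of \<open>g'\<close> serves them all.\<close>
  define Q where "Q d g g' \<longleftrightarrow> g' \<in> carrier G \<and>
    (\<forall>i\<le>9. f (ch d g (N i)) = ch d g' (N i)) \<and>
    (\<forall>i\<le>d + 2. f (urail d g i) = urail d g' i) \<and>
    (\<forall>i\<le>d + 2. f (lrail d g i) = lrail d g' i) \<and>
    f (Conn (g \<otimes> s d) d 4) = Conn (g' \<otimes> s d) d 4 \<and>
    f (Conn (g \<otimes> s d) d 3) = Conn (g' \<otimes> s d) d 3" for d g g'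
  have Q_ex: "\<exists>g'. Q d g g'" if "g \<in> carrier G" "1 \<le> d" "d \<le> k" for d g
    using f_chain[OF that] unfolding Q_def by metis
  define F where "F d g = (SOME g'. Q d g g')" for d g
  have Q: "Q d g (F d g)" if "g \<in> carrier G" "1 \<le> d" "d \<le> k" for d g
    using Q_ex[OF that] unfolding F_def by (rule someI_ex)
  have F: "F d g \<in> carrier G" if "g \<in> carrier G" "1 \<le> d" "d \<le> k" for d g
    using Q[OF that] by (simp add: Q_def)
  have N_label: "f (ch d g (N i)) = ch d (F d g) (N i)" if "g \<in> carrier G" "1 \<le> d" "d \<le> k" "i \<le> 9" for d g i
    using Q[OF that(1-3)] that(4) by (simp add: Q_def)
  have rail: "f (urail d g i) = urail d (F d g) i" "f (lrail d g i) = lrail d (F d g) i"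
    if "g \<in> carrier G" "1 \<le> d" "d \<le> k" "i \<le> d + 2" for d g i
    using Q[OF that(1-3)] that(4) by (simp_all add: Q_def)
  have C4: "f (Conn (g \<otimes> s d) d 4) = Conn (F d g \<otimes> s d) d 4"
    and C3: "f (Conn (g \<otimes> s d) d 3) = Conn (F d g \<otimes> s d) d 3"
    if "g \<in> carrier G" "1 \<le> d" "d \<le> k" for d g
    using Q[OF that] by (simp_all add: Q_def)
  have C12: "f (Conn g d 1) = Conn (F d g) d 1" "f (Conn g d 2) = Conn (F d g) d 2"
    if "g \<in> carrier G" "1 \<le> d" "d \<le> k" for d g
    using rail[OF that, of 1] by (simp_all add: urail_def lrail_def)
  have Cent1: "f (Cent g d 1) = Cent (F d g) d 1" if "g \<in> carrier G" "1 \<le> d" "d \<le> k" "2 \<le> k" for d g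
    using rail(2)[OF that(1-3), of 0] that(4) by (simp add: lrail_def)
  \<comment> \<open>Compares the chain entering \<open>g \<otimes> s d\<close> with the one leaving
    it: the first fixes the image of connector 3, the second that of the adjacent center vertex, or
    of connector 3 itself if \<open>k = 1\<close>.\<close>
  have F_s: "F d (g \<otimes> s d) = F d g \<otimes> s d" if g: "g \<in> carrier G" "1 \<le> d" "d \<le> k" for d g
  proof (cases "k = 1")
    case True
    have "lrail d h 0 = Conn h d 3" for h
      unfolding lrail_def using True by simp
    then show ?thesis
      using rail(2)[of "g \<otimes> s d" d 0] C3[OF g] g by simp
  next
    case False
    then have k: "2 \<le> k" using k_pos by linarith
    have "{Conn (g \<otimes> s d) d 3, Cent (g \<otimes> s d) d 1} \<in> E"
      using g k by (simp add: edge_simps)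
    then have "{f (Conn (g \<otimes> s d) d 3), f (Cent (g \<otimes> s d) d 1)} \<in> E"
      using g k by (simp add: f_edge Conn_in_V Cent_in_V)
    then show ?thesis
      using g k by (simp add: C3 Cent1 edge_simps)
  qed
  have C34: "f (Conn g d 3) = Conn (F d g) d 3" "f (Conn g d 4) = Conn (F d g) d 4"
    if "g \<in> carrier G" "1 \<le> d" "d \<le> k" for d g
    using C3[of "g \<otimes> inv (s d)" d] C4[of "g \<otimes> inv (s d)" d] F_s[of "g \<otimes> inv (s d)" d] that
    by simp_all
  \<comment> \<open>Connector 4 of colour \<open>d\<close> is index 0 of the upper rail of the next
    colour, so both colours prescribe its image.\<close>
  have F_succ: "F (cyclic_succ k d) g = F d g" if "g \<in> carrier G" "1 \<le> d" "d \<le> k" for d g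
    using rail(1)[of g "cyclic_succ k d" 0] C34(2)[OF that] that by (simp add: urail_def)
  have F_1: "F d g = F 1 g" if "g \<in> carrier G" "1 \<le> d" "d \<le> k" for d g
    using that(2,3)
  proof (induction d rule: dec_induct)
    case (step n)
    then show ?case using F_succ[OF that(1), of n] by (simp add: cyclic_succ_def Suc_eq_plus1)
  qed simp
  \<comment> \<open>Quantifying over all \<open>g\<close> makes the property of \<open>h\<close>
    stable under products and inverses, so it passes from the generators to the whole group.\<close>
  have F_translate: "\<forall>g\<in>carrier G. F 1 (g \<otimes> h) = F 1 g \<otimes> h" if "h \<in> generate G (s ` {1..k})" for h
    using that
  proof induction
    case one
    then show ?case using F k_pos by simp
  next
    case (incl h)
    then obtain d where "h = s d" "1 \<le> d" "d \<le> k" by auto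
    then show ?case using F_s F_1 by (metis m_closed s_closed)
  next
    case (inv h)
    then obtain d where d: "h = s d" "1 \<le> d" "d \<le> k" by auto
    show ?case
    proof
      fix g assume g: "g \<in> carrier G"
      \<comment> \<open>The rule for the generator \<open>h\<close>, taken at
        \<open>g \<otimes> inv h\<close>.\<close>
      then have "F 1 (g \<otimes> inv h) \<otimes> h = F 1 g"
        using F_s[of "g \<otimes> inv h" d] F_1[of g d] F_1[of "g \<otimes> inv h" d] d by simp
      then show "F 1 (g \<otimes> inv h) = F 1 g \<otimes> inv h"
        using d g F[of "g \<otimes> inv h" 1] k_pos s_cancel(1)[of "F 1 (g \<otimes> inv h)" d] by simp
    qed
  next
    case (eng h1 h2)
    then have "h1 \<in> carrier G" "h2 \<in> carrier G"
      by (simp_all add: s_generate)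
    with eng F k_pos show ?case by (simp flip: m_assoc)
  qed
  define x where "x = F 1 \<one>"
  have x: "x \<in> carrier G" using F k_pos by (simp add: x_def)
  have F_x: "F d g = x \<otimes> g" if "g \<in> carrier G" "1 \<le> d" "d \<le> k" for d g
    using bspec[OF F_translate[of g] one_closed] F_1[OF that] that s_generate by (simp add: x_def)
  show thesis
  proof (rule that[OF x])
    fix v assume v: "v \<in> V"
    show "f v = map_vertex (\<lambda>g. x \<otimes> g) v"
    proof (cases v)
      case [simp]: (Conn g d i)
      have g: "g \<in> carrier G" "1 \<le> d" "d \<le> k" and "i \<in> {1..4}" using v by (auto simp: Conn_in_V)
      then have "i = 1 \<or> i = 2 \<or> i = 3 \<or> i = 4" by (auto simp: One_nat_def)
      then show ?thesis
        using g by (elim disjE) (simp_all add: C12 C34 F_x)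
    next
      case [simp]: (Cent g d i)
      have g: "g \<in> carrier G" "1 \<le> d" "d \<le> k" and k: "2 \<le> k" and i: "i = 1 \<or> i = 2 \<and> 3 \<le> k"
        using v by (auto simp: Cent_in_V)
      have Fg: "F d g \<in> carrier G" using F g by simp
      from i show ?thesis
      proof
        assume "i = 1"
        then show ?thesis using g k by (simp add: Cent1 F_x)
      next
        assume i: "i = 2 \<and> 3 \<le> k"
        \<comment> \<open>Second center vertices lie on no rail; each is reached as the third
          neighbour of a first one. Both \<open>g\<close> and \<open>F d g\<close> are needed for
          \<open>h\<close>.\<close>
        have "nbr (Cent h d 1) = {Conn h d 2, Conn h d 3, Cent h d 2}" if "h \<in> carrier G" for h
          using that g i k by (simp add: nbr_Cent)
        note n = this[OF g(1)] this[OF Fg]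
        have "f (Cent g d 2) = Cent (F d g) d 2"
          by (rule third_nbr[OF _ n(1) Cent1[OF g k] C12(2)[OF g] C34(1)[OF g]])
            (use g k in \<open>simp_all add: n Cent_in_V\<close>)
        then show ?thesis using i g by (simp add: F_x)
      qed
    next
      case [simp]: (Chain d g h l)
      have g: "g \<in> carrier G" "1 \<le> d" "d \<le> k" and h: "h = g \<otimes> s d" and l: "l \<in> labels d"
        using v by (auto simp: Chain_in_V)
      have "f (ch d g l) = ch d (F d g) l"
      proof (cases l)
        case (U i)
        then show ?thesis
          using rail(1)[OF g, of "i + 1"] l by (simp add: urail_def)
      next
        case (L i)
        then show ?thesis
          using rail(2)[OF g, of "i + 1"] l by (simp add: lrail_def)
      next
        case (N i)
        then show ?thesis
          using N_label[OF g] l by simp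
      qed
      then show ?thesis
        using g x h by (simp add: F_x m_assoc)
    qed
  qed
qed

end

section \<open>Left translations as automorphisms\<close>

context cayley_blow_up
begin

text \<open>The restriction makes the map extensional, as membership in \<open>Bij V\<close>
  demands.\<close>

definition translation :: "'a \<Rightarrow> 'a vertex \<Rightarrow> 'a vertex" where
  "translation x = restrict (map_vertex (\<lambda>g. x \<otimes> g)) V"

lemma map_vertex_in_V:
  assumes "x \<in> carrier G" "v \<in> V"
  shows "map_vertex (\<lambda>g. x \<otimes> g) v \<in> V"
  using assms by (cases v) (auto simp: Conn_in_V Cent_in_V Chain_in_V m_assoc)

lemma map_vertex_mult:
  assumes "x \<in> carrier G" "y \<in> carrier G" "v \<in> V"
  shows "map_vertex (\<lambda>g. x \<otimes> g) (map_vertex (\<lambda>g. y \<otimes> g) v) = map_vertex (\<lambda>g. x \<otimes> y \<otimes> g) v"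
  using assms by (cases v) (auto simp: Conn_in_V Cent_in_V Chain_in_V m_assoc)

lemma map_vertex_one: "v \<in> V \<Longrightarrow> map_vertex (\<lambda>g. \<one> \<otimes> g) v = v"
  by (cases v) (auto simp: Conn_in_V Cent_in_V Chain_in_V)

text \<open>Edges refer to group elements only through \<open>g\<close> and
  \<open>g \<otimes> s d\<close>, and left multiplication commutes with right multiplication by
  \<open>s d\<close>.\<close>

lemma map_vertex_edge:
  assumes "x \<in> carrier G" "{u, v} \<in> E"
  shows "{map_vertex (\<lambda>g. x \<otimes> g) u, map_vertex (\<lambda>g. x \<otimes> g) v} \<in> E"
  using assms by (cases u; cases v) (auto simp: edge_simps m_assoc)

text \<open>\<open>inv x\<close> provides the inverse map, and also the converse direction for
  edges.\<close>

lemma translation_in_graph_aut: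
  assumes x: "x \<in> carrier G"
  shows "translation x \<in> graph_aut (D_graph G k s)"
proof -
  let ?m = "\<lambda>x. map_vertex (\<lambda>g. x \<otimes> g)"
  have inv: "?m (inv x) (?m x v) = v" "?m x (?m (inv x) v) = v" if "v \<in> V" for v
    using x that by (simp_all add: map_vertex_mult map_vertex_one)
  have "bij_betw (?m x) V V"
    using x inv map_vertex_in_V by (intro bij_betw_byWitness[where f' = "?m (inv x)"]) auto
  then have "translation x \<in> Bij V"
    by (simp add: Bij_def translation_def cong: bij_betw_cong)
  moreover have "{?m x u, ?m x v} \<in> E \<longleftrightarrow> {u, v} \<in> E" if "u \<in> V" "v \<in> V" for u v
    using map_vertex_edge[OF x, of u v] map_vertex_edge[of "inv x" "?m x u" "?m x v"] x inv that by auto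
  ultimately show ?thesis
    by (simp add: graph_aut_def translation_def)
qed

lemma translation_hom: "translation \<in> hom G (Aut (D_graph G k s))"
proof (rule homI)
  fix x assume "x \<in> carrier G"
  then show "translation x \<in> carrier (Aut (D_graph G k s))"
    by (simp add: Aut_def translation_in_graph_aut)
next
  fix x y assume xy: "x \<in> carrier G" "y \<in> carrier G"
  then have "translation x \<in> Bij V" "translation y \<in> Bij V"
    using translation_in_graph_aut by (auto simp: graph_aut_def)
  then have "translation x \<otimes>\<^bsub>Aut (D_graph G k s)\<^esub> translation y = compose V (translation x) (translation y)"
    by (simp add: Aut_def BijGroup_def)
  also have "\<dots> = translation (x \<otimes> y)"
    using xy by (auto simp: fun_eq_iff compose_def translation_def map_vertex_in_V map_vertex_mult)
  finally show "translation (x \<otimes> y) = translation x \<otimes>\<^bsub>Aut (D_graph G k s)\<^esub> translation y" ..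
qed

text \<open>The image of a vertex over \<open>\<one>\<close> displays \<open>x\<close>; such a
  vertex exists because \<open>k \<ge> 1\<close>.\<close>

lemma translation_inj: "inj_on translation (carrier G)"
proof (rule inj_onI)
  fix x y assume xy: "x \<in> carrier G" "y \<in> carrier G" "translation x = translation y"
  have "Conn \<one> 1 1 \<in> V" using k_pos by (simp add: Conn_in_V)
  with xy show "x = y"
    by (auto simp: translation_def dest!: fun_cong[where x = "Conn \<one> 1 1"])
qed

lemma graph_aut_translation:
  assumes "f \<in> graph_aut (D_graph G k s)"
  shows "f \<in> translation ` carrier G"
proof -
  interpret blow_up_aut G k s f by unfold_locales (rule assms)
  obtain x where x: "x \<in> carrier G" "\<And>v. v \<in> V \<Longrightarrow> f v = map_vertex (\<lambda>g. x \<otimes> g) v"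
    using f_eq_translation by metis
  have "f \<in> extensional V" using assms by (simp add: graph_aut_def Bij_def)
  with x(2) have "f = translation x"
    by (auto simp: translation_def fun_eq_iff extensional_def)
  with x(1) show ?thesis by blast
qed

lemma translation_iso: "translation \<in> iso G (Aut (D_graph G k s))"
proof -
  have "translation ` carrier G = graph_aut (D_graph G k s)"
    using graph_aut_translation translation_in_graph_aut by blast
  then show ?thesis
    using translation_hom translation_inj by (simp add: iso_def bij_betw_def Aut_def)
qed

end

theorem theorem3p7:
  fixes G :: "('a, 'm) monoid_scheme" and S :: "'a set" and s :: "nat \<Rightarrow> 'a" and k :: nat
  assumes "group G" and "finite (carrier G)"
    and "S \<subseteq> carrier G" and "generate G S = carrier G"
    and "k \<ge> 1" and "bij_betw s {1..k} S"
  shows "Aut (D_graph G k s) \<cong> G"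
proof -
  have S: "s ` {1..k} = S" using assms(6) by (simp add: bij_betw_def)
  interpret group G by fact
  interpret cayley_blow_up G k s
  proof
    fix d assume "1 \<le> d" "d \<le> k"
    then show "s d \<in> carrier G" using S assms(3) by auto
  qed (simp_all add: assms(4,5) S)
  show ?thesis
    using iso_set_sym[OF translation_iso] by (auto simp: is_iso_def)
qed

end
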